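(* Let $\nu$ be a probability measure on $\mathcal X^n$ that fulfills approximate tensorization of entropy with constant $\kappa\ge 1$, and let $X\sim\nu$. Let $f:\mathcal X^n\to\mathbb R$ be a measurable function which fulfills the bounded differences property with constants $c=(c_1,\dots,c_n)^\top$, $c_i\ge 0$. Then for all $t>0$, $$\mathbb P\left(|f(X)-\mathbb E[f(X)]|\ge t\right)\le 2\exp\left(-\frac{2t^2}{\kappa\|c\|_2^2}\right).$$
   Context: $\mathcal X$ is a measurable space for which regular conditional probabilities exist (e.g. standard Borel). For $x\in\mathcal X^n$, $x_{-i}$ denotes all entries of $x$ except the $i$-th, and $\nu(\cdot\mid x_{-i})$ is the conditional law under $\nu$ of the $i$-th coordinate given the others. Bounded differences property with constants $c_1,\dots,c_n\ge0$: for every $i\in\{1,\dots,n\}$, $\sup_{y,x_1,\dots,x_n\in\mathcal X}|f(x_1,\dots,x_n)-f(x_1,\dots,x_{i-1},y,x_{i+1},\dots,x_n)|\le c_i$. Entropy: for a probability measure $\nu$ and $f\ge 0$ such that $f$ and $f|\log f|$ are $\nu$-integrable, $\operatorname{Ent}_\nu(f):=\int f\log f\,d\nu-\left(\int f\,d\nu\right)\log\left(\int f\,d\nu\right)$. Approximate tensorization of entropy (ATE) with constant $\kappa\ge1$ ($\kappa$-ATE): for all $f:\mathcal X^n\to[0,\infty)$ for which the quantities involved exist, with $X\sim\nu$, $$\operatorname{Ent}_\nu(f)\le\kappa\sum_{i=1}^n\mathbb E\left[\operatorname{Ent}_{\nu(\cdot\mid X_{-i})}(f)\right],$$ where in the $i$-th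 term $f$ is regarded as a function of the $i$-th coordinate with the other coordinates fixed to $X_{-i}$. Convention: if $c=0$ the right-hand side of the concentration bound is read as $0$. *)

theory Defs
  imports "HOL-Probability.Probability"
begin

text \<open>
  The product space of \<open>n\<close> copies of a measurable space \<open>M\<close> is
  \<open>Pi\<^sub>M {1..n} (\<lambda>_. M)\<close>; its points are functions on \<open>nat\<close> that are
  \<open>undefined\<close> outside \<open>{1..n}\<close>.
\<close>

abbreviation power_space :: "nat \<Rightarrow> 'a measure \<Rightarrow> (nat \<Rightarrow> 'a) measure"
  where "power_space n M \<equiv> Pi\<^sub>M {1..n} (\<lambda>_. M)"

definition others :: "nat \<Rightarrow> nat \<Rightarrow> (nat \<Rightarrow> 'a) \<Rightarrow> (nat \<Rightarrow> 'a)"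
  where "others n i x = restrict x ({1..n} - {i})"

text \<open>
  \<open>K\<close> is a regular version of the conditional law under \<open>\<nu>\<close> of the \<open>i\<close>-th coordinate
  given all the other ones: a probability kernel from \<open>Pi\<^sub>M ({1..n} - {i}) (\<lambda>_. M)\<close>
  to \<open>M\<close> that disintegrates \<open>\<nu>\<close>.
\<close>

definition regular_conditional_law ::
    "nat \<Rightarrow> 'a measure \<Rightarrow> (nat \<Rightarrow> 'a) measure \<Rightarrow> nat \<Rightarrow> ((nat \<Rightarrow> 'a) \<Rightarrow> 'a measure) \<Rightarrow> bool"
  where "regular_conditional_law n M \<nu> i K \<longleftrightarrow>
    K \<in> measurable (Pi\<^sub>M ({1..n} - {i}) (\<lambda>_. M)) (prob_algebra M) \<and>
    (\<forall>A \<in> sets (Pi\<^sub>M ({1..n} - {i}) (\<lambda>_. M)). \<forall>B \<in> sets M.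
      emeasure \<nu> {x \<in> space \<nu>. others n i x \<in> A \<and> x i \<in> B} =
      (\<integral>\<^sup>+ x. indicator A (others n i x) * emeasure (K (others n i x)) B \<partial>\<nu>))"

definition bounded_differences ::
    "nat \<Rightarrow> 'a measure \<Rightarrow> (nat \<Rightarrow> real) \<Rightarrow> ((nat \<Rightarrow> 'a) \<Rightarrow> real) \<Rightarrow> bool"
  where "bounded_differences n M c f \<longleftrightarrow>
    (\<forall>i \<in> {1..n}. \<forall>x \<in> space (power_space n M). \<forall>y \<in> space M.
      \<bar>f x - f (x(i := y))\<bar> \<le> c i)"

text \<open>The usual convention \<open>0 * log 0 = 0\<close> holds since \<open>ln 0 = 0\<close> in HOL.\<close>

definition Ent_exists :: "'b measure \<Rightarrow> ('b \<Rightarrow> real) \<Rightarrow> bool"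
  where "Ent_exists \<nu> f \<longleftrightarrow>
    (\<forall>x \<in> space \<nu>. 0 \<le> f x) \<and> integrable \<nu> f \<and> integrable \<nu> (\<lambda>x. f x * \<bar>ln (f x)\<bar>)"

definition Ent :: "'b measure \<Rightarrow> ('b \<Rightarrow> real) \<Rightarrow> real"
  where "Ent \<nu> f =
    (\<integral>x. f x * ln (f x) \<partial>\<nu>) - (\<integral>x. f x \<partial>\<nu>) * ln (\<integral>x. f x \<partial>\<nu>)"

text \<open>
  \<open>cond_Ent n K i f x\<close> is the entropy, under the conditional law of the \<open>i\<close>-th coordinate
  given the other coordinates of \<open>x\<close>, of \<open>f\<close> as a function of the \<open>i\<close>-th coordinate.
\<close>

definition cond_Ent ::
    "nat \<Rightarrow> (nat \<Rightarrow> (nat \<Rightarrow> 'a) \<Rightarrow> 'a measure) \<Rightarrow> nat \<Rightarrow> ((nat \<Rightarrow> 'a) \<Rightarrow> real) \<Rightarrow> (nat \<Rightarrow> 'a) \<Rightarrow> real"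
  where "cond_Ent n K i f x = Ent (K i (others n i x)) (\<lambda>y. f (x(i := y)))"

text \<open>
  Approximate tensorization of entropy is required of those nonnegative \<open>f\<close> for which all
  the quantities involved exist, so that no integral below takes its default value \<open>0\<close>.
  The family \<open>K\<close> is meant to consist of the regular conditional laws of \<open>\<nu>\<close>; replacing it
  by another version changes the conditional entropy of each such \<open>f\<close> on a \<open>\<nu>\<close>-null set only.
\<close>

definition approx_tensorization_entropy ::
    "nat \<Rightarrow> (nat \<Rightarrow> 'a) measure \<Rightarrow> (nat \<Rightarrow> (nat \<Rightarrow> 'a) \<Rightarrow> 'a measure) \<Rightarrow> real \<Rightarrow> bool"
  where "approx_tensorization_entropy n \<nu> K \<kappa> \<longleftrightarrow>
    (\<forall>f. Ent_exists \<nu> f \<and>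
         (\<forall>i \<in> {1..n}.
            (AE x in \<nu>. Ent_exists (K i (others n i x)) (\<lambda>y. f (x(i := y)))) \<and>
            integrable \<nu> (cond_Ent n K i f)) \<longrightarrow>
         Ent \<nu> f \<le> \<kappa> * (\<Sum>i = 1..n. \<integral>x. cond_Ent n K i f x \<partial>\<nu>))"

end

theory Submission
  imports Defs
begin

text \<open>
  The proof is the entropy method. Let \<open>Z(l) = E exp (l * f(X))\<close>. Conditionally on the other
  coordinates, \<open>f\<close> varies by at most \<open>c i\<close> in its \<open>i\<close>-th coordinate, and for a variable of
  oscillation \<open>d\<close> the entropy of its exponential is at most \<open>d\<^sup>2 / 8\<close> times the mean of that
  exponential (\<open>Ent_exp_le_oscillation\<close>); this is Hoeffding's lemma for the exponentially tilted law.
  Approximate tensorization sums the conditional bounds to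
  \<open>Ent (exp (l * f)) \<le> l\<^sup>2 * v / 2 * Z(l)\<close> with \<open>v = \<kappa> * (\<Sum>i. (c i)\<^sup>2) / 4\<close>
  (\<open>approx_tensorization_Ent_exp_le\<close>). This is a differential inequality for \<open>ln Z(l) / l\<close>, which
  Herbst's argument integrates to the Gaussian bound \<open>ln Z(l) \<le> l * E f(X) + l\<^sup>2 * v / 2\<close>
  (\<open>Herbst_mgf_bound\<close>), and Chernoff's method gives the tail \<open>exp (- t\<^sup>2 / (2 * v))\<close>. The same for
  \<open>- f\<close> accounts for the factor \<open>2\<close>. If all \<open>c i\<close> vanish then \<open>v = 0\<close> and \<open>f\<close> is constant.

  The measure-theoretic point is that the conditional entropies are integrable and that the
  conditional means of \<open>exp f\<close> average to its mean. Both are read off from the kernel that redraws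
  one coordinate from its conditional law, which leaves \<open>\<nu>\<close> invariant (\<open>bind_resample_eq\<close>).
\<close>

section \<open>Entropy of the exponential of a bounded variable\<close>

lemma (in prob_space) integrable_exp_bounded:
  fixes X :: "'a \<Rightarrow> real"
  assumes [measurable]: "X \<in> borel_measurable M"
    and bd: "\<And>x. x \<in> space M \<Longrightarrow> \<bar>X x\<bar> \<le> B"
  shows "integrable M (\<lambda>x. exp (X x))"
proof (rule integrable_const_bound[of _ "exp B"])
  show "AE x in M. norm (exp (X x)) \<le> exp B"
  proof (rule AE_I2)
    fix x assume "x \<in> space M"
    then show "norm (exp (X x)) \<le> exp B" using bd[of x] by simp
  qed
qed simp

lemma (in prob_space) expectation_exp_bounds:
  fixes X :: "'a \<Rightarrow> real"
  assumes [measurable]: "X \<in> borel_measurable M"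
    and bd: "\<And>x. x \<in> space M \<Longrightarrow> \<bar>X x\<bar> \<le> B"
  shows "exp (- B) \<le> expectation (\<lambda>x. exp (X x))"
    and "expectation (\<lambda>x. exp (X x)) \<le> exp B"
    and "expectation (\<lambda>x. exp (X x)) > 0"
proof -
  have B: "- B \<le> X x \<and> X x \<le> B" if "x \<in> space M" for x
    using bd[OF that] by linarith
  show lower: "exp (- B) \<le> expectation (\<lambda>x. exp (X x))"
    by (rule integral_ge_const[OF integrable_exp_bounded[OF assms]]) (use B in \<open>auto intro!: AE_I2\<close>)
  show "expectation (\<lambda>x. exp (X x)) \<le> exp B"
    by (rule integral_le_const[OF integrable_exp_bounded[OF assms]]) (use B in \<open>auto intro!: AE_I2\<close>)
  show "expectation (\<lambda>x. exp (X x)) > 0"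
    using lower exp_gt_zero[of "- B"] by linarith
qed

lemma (in prob_space) exp_times_exponent_bounded:
  fixes X :: "'a \<Rightarrow> real"
  assumes [measurable]: "X \<in> borel_measurable M"
    and bd: "\<And>x. x \<in> space M \<Longrightarrow> \<bar>X x\<bar> \<le> B"
  shows "integrable M (\<lambda>x. exp (X x) * X x)"
    and "\<bar>expectation (\<lambda>x. exp (X x) * X x)\<bar> \<le> exp B * B"
proof -
  have pt: "\<bar>exp (X x) * X x\<bar> \<le> exp B * B" if "x \<in> space M" for x
    using bd[OF that] by (auto simp: abs_mult intro!: mult_mono)
  show int: "integrable M (\<lambda>x. exp (X x) * X x)"
    by (rule integrable_const_bound[of _ "exp B * B"]) (use pt in \<open>auto intro!: AE_I2\<close>)
  have "\<bar>expectation (\<lambda>x. exp (X x) * X x)\<bar> \<le> expectation (\<lambda>x. \<bar>exp (X x) * X x\<bar>)"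
    by (rule integral_abs_bound)
  also have "\<dots> \<le> exp B * B"
    by (rule integral_le_const[OF integrable_abs[OF int]]) (rule AE_I2, rule pt)
  finally show "\<bar>expectation (\<lambda>x. exp (X x) * X x)\<bar> \<le> exp B * B" .
qed

lemma (in prob_space) Ent_exists_exp_bounded:
  fixes X :: "'a \<Rightarrow> real"
  assumes "X \<in> borel_measurable M" and "\<And>x. x \<in> space M \<Longrightarrow> \<bar>X x\<bar> \<le> B"
  shows "Ent_exists M (\<lambda>x. exp (X x))"
  using integrable_exp_bounded[OF assms] integrable_abs[OF exp_times_exponent_bounded(1)[OF assms]]
  unfolding Ent_exists_def by (simp add: abs_mult)

text \<open>
  A crude bound, whose use is that it is uniform in the measure: it makes the conditional entropies
  of a bounded function integrable.
\<close>

lemma (in prob_space) abs_Ent_exp_le: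
  fixes X :: "'a \<Rightarrow> real"
  assumes "X \<in> borel_measurable M" and "\<And>x. x \<in> space M \<Longrightarrow> \<bar>X x\<bar> \<le> B"
  shows "\<bar>Ent M (\<lambda>x. exp (X x))\<bar> \<le> 2 * (exp B * B)"
proof -
  define Z where "Z = expectation (\<lambda>x. exp (X x))"
  note Z = expectation_exp_bounds[OF assms, folded Z_def]
  have "\<bar>ln Z\<bar> \<le> B"
    using ln_mono[OF Z(1)] ln_mono[OF Z(2)] Z(3) by simp
  then have "\<bar>Z * ln Z\<bar> \<le> exp B * B"
    using Z by (auto simp: abs_mult intro!: mult_mono)
  then show ?thesis
    using exp_times_exponent_bounded(2)[OF assms]
    unfolding Ent_def Z_def[symmetric] ln_exp by linarith
qed

lemma oscillation_imp_interval:
  fixes X :: "'b \<Rightarrow> real"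
  assumes "\<And>x y. x \<in> S \<Longrightarrow> y \<in> S \<Longrightarrow> \<bar>X x - X y\<bar> \<le> d"
  obtains a where "\<And>x. x \<in> S \<Longrightarrow> a \<le> X x \<and> X x \<le> a + d"
proof (cases "S = {}")
  case False
  have bdd: "bdd_below (X ` S)"
  proof -
    obtain z where z: "z \<in> S" using False by blast
    show ?thesis
    proof (rule bdd_belowI2)
      fix x assume "x \<in> S"
      then show "X z - d \<le> X x" using assms[OF z, of x] by linarith
    qed
  qed
  have "Inf (X ` S) \<le> X x \<and> X x \<le> Inf (X ` S) + d" if x: "x \<in> S" for x
  proof
    show "Inf (X ` S) \<le> X x"
      using bdd x by (intro cInf_lower) auto
    have "X x - d \<le> Inf (X ` S)"
    proof (rule cInf_greatest)
      fix r assume "r \<in> X ` S"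
      then show "X x - d \<le> r" using assms[OF x] by fastforce
    qed (use False in simp)
    then show "X x \<le> Inf (X ` S) + d" by linarith
  qed
  then show ?thesis using that by blast
qed (use that in blast)

text \<open>
  With \<open>Z = E exp X\<close> and \<open>Q\<close> the probability measure of density \<open>exp X / Z\<close>, the ratio
  \<open>Ent (exp X) / Z\<close> equals \<open>E\<^sub>Q X - ln Z\<close>, and since \<open>E\<^sub>Q exp (- X) = 1 / Z\<close> this is the
  logarithm of \<open>E\<^sub>Q exp (E\<^sub>Q X - X)\<close>. Hoeffding's lemma for \<open>- X\<close> under \<open>Q\<close> bounds it by
  \<open>d\<^sup>2 / 8\<close>.
\<close>

lemma (in prob_space) Ent_exp_le_oscillation:
  fixes X :: "'a \<Rightarrow> real"
  assumes [measurable]: "X \<in> borel_measurable M"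
    and osc: "\<And>x y. x \<in> space M \<Longrightarrow> y \<in> space M \<Longrightarrow> \<bar>X x - X y\<bar> \<le> d"
  shows "Ent M (\<lambda>x. exp (X x)) \<le> d\<^sup>2 / 8 * expectation (\<lambda>x. exp (X x))"
proof -
  obtain a where a: "\<And>x. x \<in> space M \<Longrightarrow> a \<le> X x \<and> X x \<le> a + d"
    by (rule oscillation_imp_interval[of "space M" X d]) (use osc in auto)
  define Z where "Z = expectation (\<lambda>x. exp (X x))"
  have int_exp: "integrable M (\<lambda>x. exp (X x))"
    by (rule integrable_const_bound[of _ "exp (a + d)"]) (use a in auto)
  have "exp a \<le> Z"
    unfolding Z_def using a int_exp
    by (intro integral_ge_const) auto
  then have Z: "Z > 0"
    using exp_gt_zero[of a] by linarith
  define w where "w = (\<lambda>x. exp (X x) / Z)"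
  have w [measurable]: "w \<in> borel_measurable M" and w0: "\<And>x. 0 \<le> w x"
    using Z by (auto simp: w_def)
  define Q where "Q = density M (\<lambda>x. ennreal (w x))"
  have int_Q: "(\<integral>x. g x \<partial>Q) = (\<integral>x. w x * g x \<partial>M)"
    if "g \<in> borel_measurable M" for g :: "'a \<Rightarrow> real"
    unfolding Q_def using that w0 by (subst integral_density) auto
  have "integrable M w"
    unfolding w_def using int_exp by simp
  moreover have "expectation w = 1"
    unfolding w_def using Z by (simp add: Z_def[symmetric])
  ultimately have "emeasure Q (space Q) = 1"
    unfolding Q_def using w0 by (simp add: emeasure_density nn_integral_eq_integral)
  then interpret Q: prob_space Q by (rule prob_spaceI)
  have meas_Q: "g \<in> borel_measurable Q \<longleftrightarrow> g \<in> borel_measurable M" for g :: "'a \<Rightarrow> real"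
    by (simp add: Q_def)
  have space_Q: "space Q = space M"
    by (simp add: Q_def)
  interpret H: interval_bounded_random_variable Q "\<lambda>x. - X x" "- (a + d)" "- a"
  proof unfold_locales
    show "(\<lambda>x. - X x) \<in> borel_measurable Q" by (simp add: meas_Q)
    show "AE x in Q. - X x \<in> {- (a + d)..- a}"
    proof (rule AE_I2)
      fix x assume "x \<in> space Q"
      then show "- X x \<in> {- (a + d)..- a}" using a[of x] by (simp add: space_Q)
    qed
  qed
  define m where "m = (\<integral>x. X x \<partial>Q)"
  \<comment> \<open>Hoeffding's lemma needs a positive parameter, hence its use for \<open>- X\<close> with parameter \<open>1\<close>.\<close>
  have "ennreal (\<integral>x. exp (m - X x) \<partial>Q) = (\<integral>\<^sup>+x. ennreal (exp (m - X x)) \<partial>Q)"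
  proof (intro nn_integral_eq_integral[symmetric] Q.integrable_const_bound[of _ "exp (m - a)"])
    show "AE x in Q. norm (exp (m - X x)) \<le> exp (m - a)"
      by (rule AE_I2) (use a in \<open>simp add: space_Q\<close>)
  qed (simp_all add: meas_Q)
  also have "\<dots> \<le> ennreal (exp (d\<^sup>2 / 8))"
    using H.Hoeffdings_lemma_nn_integral[of 1] by (simp add: m_def)
  finally have "(\<integral>x. exp (m - X x) \<partial>Q) \<le> exp (d\<^sup>2 / 8)" by simp
  moreover have "(\<integral>x. exp (m - X x) \<partial>Q) = exp m / Z"
    by (subst int_Q) (auto simp: w_def exp_diff prob_space)
  ultimately have "ln (exp m / Z) \<le> d\<^sup>2 / 8"
    using Z by (metis divide_pos_pos exp_gt_zero ln_exp ln_le_cancel_iff)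
  then have "(m - ln Z) * Z \<le> d\<^sup>2 / 8 * Z"
    using Z by (intro mult_right_mono) (auto simp: ln_div)
  moreover have "m = expectation (\<lambda>x. exp (X x) * X x) / Z"
    unfolding m_def by (subst int_Q) (auto simp: w_def)
  then have "(m - ln Z) * Z = expectation (\<lambda>x. exp (X x) * X x) - Z * ln Z"
    using Z by (simp add: left_diff_distrib)
  ultimately show ?thesis
    by (simp add: Ent_def Z_def[symmetric])
qed

section \<open>Herbst's argument\<close>

text \<open>
  For bounded \<open>X\<close> the remainder of the first-order expansion of \<open>exp ((l + h) * X)\<close> in \<open>h\<close> is, for
  small \<open>h\<close>, at most a constant times \<open>h\<^sup>2\<close>, uniformly in the sample point, and so is its mean.
\<close>

lemma (in prob_space) mgf_has_derivative:
  fixes X :: "'a \<Rightarrow> real"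
  assumes [measurable]: "X \<in> borel_measurable M"
    and bd: "\<And>x. x \<in> space M \<Longrightarrow> \<bar>X x\<bar> \<le> B"
  shows "((\<lambda>l. expectation (\<lambda>x. exp (l * X x))) has_real_derivative
           expectation (\<lambda>x. X x * exp (l * X x))) (at l)"
proof -
  have sX: "\<bar>s * X x\<bar> \<le> \<bar>s\<bar> * B" if "x \<in> space M" for x s
    using mult_left_mono[OF bd[OF that], of "\<bar>s\<bar>"] by (simp add: abs_mult)
  then have lX: "s * X x \<le> \<bar>s\<bar> * B" if "x \<in> space M" for x s
    using that by (meson abs_le_iff)
  have int1 [simp]: "integrable M (\<lambda>x. exp (s * X x))" for s
    by (rule integrable_exp_bounded[OF _ sX]) auto
  have int2 [simp]: "integrable M (\<lambda>x. X x * exp (s * X x))" for s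
  proof (rule integrable_const_bound[of _ "B * exp (\<bar>s\<bar> * B)"])
    show "AE x in M. norm (X x * exp (s * X x)) \<le> B * exp (\<bar>s\<bar> * B)"
    proof (rule AE_I2)
      fix x assume "x \<in> space M"
      then show "norm (X x * exp (s * X x)) \<le> B * exp (\<bar>s\<bar> * B)"
        using bd[of x] lX[of x s] by (auto simp: abs_mult intro!: mult_mono)
    qed
  qed simp
  define F where "F = (\<lambda>s. expectation (\<lambda>x. exp (s * X x)))"
  define D where "D = expectation (\<lambda>x. X x * exp (l * X x))"
  define C where "C = (\<lambda>h. exp (\<bar>l\<bar> * B) * (B\<^sup>2 * exp (\<bar>h\<bar> * B) / 2))"
  have rem: "\<bar>F (l + h) - F l - h * D\<bar> \<le> C h * h\<^sup>2" for h
  proof -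
    have pt: "\<bar>exp ((l + h) * X x) - exp (l * X x) - h * (X x * exp (l * X x))\<bar> \<le> C h * h\<^sup>2"
      if x: "x \<in> space M" for x
    proof -
      obtain t where t: "\<bar>t\<bar> \<le> \<bar>h * X x\<bar>"
          "exp (h * X x) = (\<Sum>m<2. (h * X x) ^ m / fact m) + exp t / fact 2 * (h * X x) ^ 2"
        using Maclaurin_exp_le[of "h * X x" 2] by blast
      have t2: "exp (h * X x) - 1 - h * X x = exp t / 2 * (h * X x)\<^sup>2"
        using t(2) by (simp add: numeral_2_eq_2)
      have "t \<le> \<bar>h\<bar> * B"
        using t(1) mult_left_mono[OF bd[OF x], of "\<bar>h\<bar>"] by (simp add: abs_mult)
      moreover have "(X x)\<^sup>2 \<le> B\<^sup>2"
        using bd[OF x] by (metis abs_le_square_iff abs_of_nonneg abs_ge_zero order_trans)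
      ultimately have "exp t / 2 * (h * X x)\<^sup>2 \<le> exp (\<bar>h\<bar> * B) / 2 * (h\<^sup>2 * B\<^sup>2)"
        by (intro mult_mono) (auto simp: power_mult_distrib mult_left_mono)
      from mult_mono[OF _ this, of "exp (l * X x)" "exp (\<bar>l\<bar> * B)"]
      have le: "exp (l * X x) * (exp t / 2 * (h * X x)\<^sup>2)
          \<le> exp (\<bar>l\<bar> * B) * (exp (\<bar>h\<bar> * B) / 2 * (h\<^sup>2 * B\<^sup>2))"
        using lX[OF x, of l] by simp
      have eq: "exp ((l + h) * X x) - exp (l * X x) - h * (X x * exp (l * X x))
          = exp (l * X x) * (exp t / 2 * (h * X x)\<^sup>2)"
        unfolding t2[symmetric] by (simp add: algebra_simps exp_add)
      show ?thesis
        unfolding eq using le by (subst abs_of_nonneg) (simp_all add: C_def mult_ac)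
    qed
    have int: "integrable M (\<lambda>x. exp ((l + h) * X x) - exp (l * X x) - h * (X x * exp (l * X x)))"
      by (intro Bochner_Integration.integrable_diff integrable_mult_right int1 int2)
    have "\<bar>F (l + h) - F l - h * D\<bar> =
        \<bar>expectation (\<lambda>x. exp ((l + h) * X x) - exp (l * X x) - h * (X x * exp (l * X x)))\<bar>"
      by (simp add: F_def D_def)
    also have "\<dots> \<le> expectation (\<lambda>x. \<bar>exp ((l + h) * X x) - exp (l * X x) - h * (X x * exp (l * X x))\<bar>)"
      by (rule integral_abs_bound)
    also have "\<dots> \<le> C h * h\<^sup>2"
      by (rule integral_le_const[OF integrable_abs[OF int]]) (rule AE_I2, rule pt)
    finally show ?thesis .
  qed
  have "((\<lambda>h. (F (l + h) - F l) / h - D) \<longlongrightarrow> 0) (at 0)"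
  proof (rule Lim_null_comparison)
    show "\<forall>\<^sub>F h in at 0. norm ((F (l + h) - F l) / h - D) \<le> C h * \<bar>h\<bar>"
    proof (rule eventually_at_topological[THEN iffD2], intro exI[of _ UNIV], safe)
      fix h :: real assume h: "h \<noteq> 0"
      have "(F (l + h) - F l) / h - D = (F (l + h) - F l - h * D) / h"
        using h by (simp add: field_simps)
      then show "norm ((F (l + h) - F l) / h - D) \<le> C h * \<bar>h\<bar>"
        using rem[of h] h by (simp add: divide_le_eq power2_eq_square mult.assoc)
    qed simp_all
    show "((\<lambda>h. C h * \<bar>h\<bar>) \<longlongrightarrow> 0) (at 0)"
      unfolding C_def by (auto intro!: tendsto_eq_intros)
  qed
  then have "((\<lambda>h. (F (l + h) - F l) / h) \<longlongrightarrow> D) (at 0)"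
    by (simp add: LIM_zero_iff)
  then show ?thesis
    by (simp add: DERIV_def F_def D_def)
qed

text \<open>
  Herbst's argument. Let \<open>\<psi> s = ln (E exp (s * X))\<close>. Then
  \<open>Ent (exp (s * X)) = (s * \<psi>' s - \<psi> s) * E exp (s * X)\<close>, and \<open>s * \<psi>' s - \<psi> s\<close> is \<open>s\<^sup>2\<close> times
  the derivative of \<open>\<psi> s / s\<close>. So the entropy bound says that \<open>\<psi> s / s - s * v / 2\<close> decreases
  on the positive reals; its limit at \<open>0\<close> is \<open>\<psi>' 0 = E X\<close>.
\<close>

lemma (in prob_space) Herbst_mgf_bound:
  fixes X :: "'a \<Rightarrow> real"
  assumes [measurable]: "X \<in> borel_measurable M"
    and bd: "\<And>x. x \<in> space M \<Longrightarrow> \<bar>X x\<bar> \<le> B"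
    and Ent_le: "\<And>l. l > 0 \<Longrightarrow>
      Ent M (\<lambda>x. exp (l * X x)) \<le> l\<^sup>2 * v / 2 * expectation (\<lambda>x. exp (l * X x))"
    and l: "l > 0"
  shows "expectation (\<lambda>x. exp (l * X x)) \<le> exp (l * expectation X + l\<^sup>2 * v / 2)"
proof -
  define F where "F = (\<lambda>s. expectation (\<lambda>x. exp (s * X x)))"
  define D where "D = (\<lambda>s. expectation (\<lambda>x. X x * exp (s * X x)))"
  have F_pos: "F s > 0" for s
    unfolding F_def
  proof (rule expectation_exp_bounds(3))
    show "\<bar>s * X x\<bar> \<le> \<bar>s\<bar> * B" if "x \<in> space M" for x
      using mult_left_mono[OF bd[OF that], of "\<bar>s\<bar>"] by (simp add: abs_mult)
  qed simp
  have F0: "F 0 = 1" and D0: "D 0 = expectation X"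
    by (simp_all add: F_def D_def prob_space)
  define \<psi> where "\<psi> = (\<lambda>s. ln (F s))"
  have F_deriv: "(F has_real_derivative D s) (at s)" for s
    unfolding F_def D_def using bd by (intro mgf_has_derivative) auto
  have \<psi>_deriv: "(\<psi> has_real_derivative D s / F s) (at s)" for s
    unfolding \<psi>_def using F_deriv F_pos
    by (auto intro!: derivative_eq_intros simp: field_simps)
  define g where "g = (\<lambda>s. \<psi> s / s - s * v / 2)"
  have g_mono: "g l \<le> g s" if s: "0 < s" "s < l" for s
  proof (rule DERIV_nonpos_imp_nonincreasing[where f = g and a = s and b = l])
    show "s \<le> l" using s by simp
    fix u assume u: "s \<le> u" "u \<le> l"
    then have u0: "u > 0" using s by simp
    have "(\<integral>x. exp (u * X x) * (u * X x) \<partial>M) = u * D u"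
      unfolding D_def by (subst integral_mult_right_zero[symmetric]) (simp add: mult_ac)
    then have "u * D u - F u * \<psi> u \<le> u\<^sup>2 * v / 2 * F u"
      using Ent_le[OF u0] by (simp add: Ent_def F_def \<psi>_def)
    then have "(u * D u - F u * \<psi> u) / (F u * u\<^sup>2) \<le> v / 2"
      using F_pos[of u] u0 by (simp add: divide_le_eq mult_ac)
    then have "(D u / F u * u - \<psi> u * 1) / (u * u) - v / 2 \<le> 0"
      using F_pos[of u] u0 by (simp add: field_simps power2_eq_square)
    moreover have "(g has_real_derivative (D u / F u * u - \<psi> u * 1) / (u * u) - v / 2) (at u)"
      unfolding g_def using \<psi>_deriv[of u] u0
      by (auto intro!: derivative_eq_intros DERIV_divide)
    ultimately show "\<exists>y. (g has_real_derivative y) (at u) \<and> y \<le> 0" by blast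
  qed
  \<comment> \<open>At \<open>0\<close> the quotient \<open>\<psi> s / s\<close> is the difference quotient of \<open>\<psi>\<close>, as \<open>\<psi> 0 = 0\<close>.\<close>
  have "((\<lambda>s. \<psi> s / s) \<longlongrightarrow> expectation X) (at 0)"
    using \<psi>_deriv[of 0] by (simp add: DERIV_def F0 D0) (simp add: \<psi>_def F0)
  then have "(g \<longlongrightarrow> expectation X) (at 0)"
    unfolding g_def by (rule tendsto_eq_rhs[OF tendsto_diff]) (auto intro!: tendsto_eq_intros)
  then have "(g \<longlongrightarrow> expectation X) (at_right 0)"
    by (rule filterlim_mono[OF _ order_refl at_le]) simp
  moreover have "\<forall>\<^sub>F s in at_right 0. g l \<le> g s"
    using g_mono l by (auto simp: eventually_at_right)
  ultimately have "g l \<le> expectation X"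
    by (intro tendsto_lowerbound[of g _ "at_right 0"]) auto
  then have "\<psi> l \<le> l * expectation X + l\<^sup>2 * v / 2"
    using l by (simp add: g_def field_simps power2_eq_square)
  moreover have "F l = exp (\<psi> l)"
    using F_pos[of l] by (simp add: \<psi>_def)
  ultimately show ?thesis
    by (simp add: F_def)
qed

lemma (in prob_space) Herbst_tail_bound:
  fixes X :: "'a \<Rightarrow> real"
  assumes [measurable]: "X \<in> borel_measurable M"
    and bd: "\<And>x. x \<in> space M \<Longrightarrow> \<bar>X x\<bar> \<le> B"
    and Ent_le: "\<And>l. l > 0 \<Longrightarrow>
      Ent M (\<lambda>x. exp (l * X x)) \<le> l\<^sup>2 * v / 2 * expectation (\<lambda>x. exp (l * X x))"
    and v: "v > 0" and t: "t > 0"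
  shows "prob {x \<in> space M. X x - expectation X \<ge> t} \<le> exp (- (t\<^sup>2 / (2 * v)))"
proof -
  \<comment> \<open>The minimizer of \<open>l\<^sup>2 * v / 2 - l * t\<close>.\<close>
  define l where "l = t / v"
  have l: "l > 0" using v t by (simp add: l_def)
  have int: "integrable M (\<lambda>x. exp (l * X x))"
  proof (rule integrable_exp_bounded)
    show "\<bar>l * X x\<bar> \<le> l * B" if "x \<in> space M" for x
      using mult_left_mono[OF bd[OF that], of l] l by (simp add: abs_mult)
  qed simp
  have "{x \<in> space M. X x - expectation X \<ge> t} = {x \<in> space M. X x \<ge> t + expectation X}"
    by auto
  also have "prob \<dots> \<le> exp (- l * (t + expectation X)) * (\<integral>x\<in>space M. exp (l * X x) \<partial>M)"
    by (rule Chernoff_ineq_ge)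
       (use l int in \<open>auto simp: set_integrable_def cong: Bochner_Integration.integrable_cong\<close>)
  also have "(\<integral>x\<in>space M. exp (l * X x) \<partial>M) = expectation (\<lambda>x. exp (l * X x))"
    by (rule set_integral_space[OF int])
  also have "exp (- l * (t + expectation X)) * \<dots>
      \<le> exp (- l * (t + expectation X)) * exp (l * expectation X + l\<^sup>2 * v / 2)"
    by (intro mult_left_mono Herbst_mgf_bound[OF _ bd Ent_le l]) auto
  also have "\<dots> = exp (l\<^sup>2 * v / 2 - l * t)"
    by (simp add: exp_add[symmetric] algebra_simps)
  also have "l\<^sup>2 * v / 2 - l * t = - (t\<^sup>2 / (2 * v))"
    using v by (simp add: l_def field_simps power2_eq_square)
  finally show ?thesis .
qed

section \<open>Functions with bounded differences\<close>

lemma measurable_coordinate_update: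
  assumes "i \<in> {1..n}"
  shows "(\<lambda>(x, y). x(i := y)) \<in> power_space n M \<Otimes>\<^sub>M M \<rightarrow>\<^sub>M power_space n M"
  using measurable_add_dim[of i "{1..n}" "\<lambda>_. M"] unfolding insert_absorb[OF assms] .

lemma update_in_power_space:
  assumes "i \<in> {1..n}" "x \<in> space (power_space n M)" "y \<in> space M"
  shows "x(i := y) \<in> space (power_space n M)"
  using measurable_space[OF measurable_coordinate_update[OF assms(1)], of "(x, y)" M] assms(2,3)
  by (simp add: space_pair_measure)

lemma measurable_others: "others n i \<in> power_space n M \<rightarrow>\<^sub>M Pi\<^sub>M ({1..n} - {i}) (\<lambda>_. M)"
  unfolding others_def by (rule measurable_restrict_subset) auto

text \<open>
  Telescoping: replace the coordinates of \<open>x0\<close> by those of \<open>x\<close> one at a time.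
\<close>

lemma bounded_differences_imp_dist_le:
  assumes bd: "bounded_differences n M c f"
    and x: "x \<in> space (power_space n M)" and x0: "x0 \<in> space (power_space n M)"
  shows "\<bar>f x - f x0\<bar> \<le> (\<Sum>i = 1..n. c i)"
proof -
  have "override_on x0 x S \<in> space (power_space n M) \<and> \<bar>f (override_on x0 x S) - f x0\<bar> \<le> sum c S"
    if "S \<subseteq> {1..n}" for S
    using finite_subset[OF that finite_atLeastAtMost] that
  proof (induction S rule: finite_induct)
    case empty
    then show ?case using x0 by simp
  next
    case (insert i S)
    let ?z = "override_on x0 x S"
    have i: "i \<in> {1..n}" and IH: "?z \<in> space (power_space n M)" "\<bar>f ?z - f x0\<bar> \<le> sum c S"
      using insert by auto
    have xi: "x i \<in> space M"
      using x i by (auto simp: space_PiM)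
    have eq: "override_on x0 x (insert i S) = ?z(i := x i)"
      by (rule override_on_insert)
    have "\<bar>f ?z - f (?z(i := x i))\<bar> \<le> c i"
      using bd i IH(1) xi unfolding bounded_differences_def by blast
    then have "\<bar>f (?z(i := x i)) - f x0\<bar> \<le> c i + sum c S"
      using IH(2) by linarith
    then show ?case
      using update_in_power_space[OF i IH(1) xi] insert.hyps
      unfolding eq by (simp del: fun_upd_apply)
  qed
  from this[of "{1..n}"] have "\<bar>f (override_on x0 x {1..n}) - f x0\<bar> \<le> sum c {1..n}"
    by simp
  moreover have "override_on x0 x {1..n} = x"
  proof
    fix j show "override_on x0 x {1..n} j = x j"
      using x x0 by (cases "j \<in> {1..n}") (auto simp: override_on_def space_PiM PiE_def extensional_def)
  qed
  ultimately show ?thesis by simp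
qed

lemma bounded_differences_scale:
  assumes "bounded_differences n M c f"
  shows "bounded_differences n M (\<lambda>i. \<bar>a\<bar> * c i) (\<lambda>x. a * f x)"
  unfolding bounded_differences_def
proof (intro ballI)
  fix i x y assume "i \<in> {1..n}" "x \<in> space (power_space n M)" "y \<in> space M"
  then have "\<bar>a\<bar> * \<bar>f x - f (x(i := y))\<bar> \<le> \<bar>a\<bar> * c i"
    using assms unfolding bounded_differences_def by (intro mult_left_mono) auto
  then show "\<bar>a * f x - a * f (x(i := y))\<bar> \<le> \<bar>a\<bar> * c i"
    by (simp add: abs_mult[symmetric] right_diff_distrib)
qed

section \<open>Resampling one coordinate\<close>

text \<open>
  The law of \<open>x\<close> after its \<open>i\<close>-th coordinate has been drawn afresh from its conditional law given
  the others, that is, one step of the Gibbs sampler. Placing this law on the whole product space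
  turns the conditional entropies into entropies of one fixed function under a probability kernel,
  to which the measurability theory of kernels applies.
\<close>

definition resample ::
    "nat \<Rightarrow> 'a measure \<Rightarrow> ((nat \<Rightarrow> 'a) \<Rightarrow> 'a measure) \<Rightarrow> nat \<Rightarrow> (nat \<Rightarrow> 'a) \<Rightarrow> (nat \<Rightarrow> 'a) measure"
  where "resample n M L i x = distr (L (others n i x)) (power_space n M) (\<lambda>y. x(i := y))"

lemma conditional_law_at_point:
  assumes "regular_conditional_law n M \<nu> i L" and "x \<in> space (power_space n M)"
  shows "prob_space (L (others n i x))" and "sets (L (others n i x)) = sets M"
proof -
  have "L \<in> Pi\<^sub>M ({1..n} - {i}) (\<lambda>_. M) \<rightarrow>\<^sub>M prob_algebra M"
    using assms(1) unfolding regular_conditional_law_def by blast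
  from measurable_space[OF this measurable_space[OF measurable_others assms(2)]]
  show "prob_space (L (others n i x))" and "sets (L (others n i x)) = sets M"
    by (simp_all add: space_prob_algebra)
qed

lemma measurable_update_at_point:
  assumes "i \<in> {1..n}" "x \<in> space (power_space n M)" "sets N = sets M"
  shows "(\<lambda>y. x(i := y)) \<in> N \<rightarrow>\<^sub>M power_space n M"
proof -
  have "(\<lambda>y. case (x, y) of (x, y) \<Rightarrow> x(i := y)) \<in> M \<rightarrow>\<^sub>M power_space n M"
    using assms(2) by (intro measurable_compose[OF measurable_Pair1' measurable_coordinate_update[OF assms(1)]])
  then show ?thesis
    using assms(3) by (simp cong: measurable_cong_sets)
qed

lemma measurable_resample:
  assumes i: "i \<in> {1..n}" and L: "regular_conditional_law n M \<nu> i L"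
  shows "resample n M L i \<in> power_space n M \<rightarrow>\<^sub>M prob_algebra (power_space n M)"
proof (rule measurable_prob_algebraI)
  fix x assume x: "x \<in> space (power_space n M)"
  show "prob_space (resample n M L i x)"
    unfolding resample_def
    using conditional_law_at_point[OF L x] measurable_update_at_point[OF i x]
    by (intro prob_space.prob_space_distr) auto
next
  have "(\<lambda>x. L (others n i x)) \<in> power_space n M \<rightarrow>\<^sub>M subprob_algebra M"
    using L unfolding regular_conditional_law_def
    by (intro measurable_prob_algebraD measurable_compose[OF measurable_others]) auto
  from measurable_distr2[OF measurable_coordinate_update[OF i] this]
  show "resample n M L i \<in> power_space n M \<rightarrow>\<^sub>M subprob_algebra (power_space n M)"
    unfolding resample_def[abs_def] .
qed

lemma resample_at_point:
  assumes i: "i \<in> {1..n}" and L: "regular_conditional_law n M \<nu> i L"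
    and x: "x \<in> space (power_space n M)"
  shows "prob_space (resample n M L i x)"
    and "sets (resample n M L i x) = sets (power_space n M)"
    and "space (resample n M L i x) = space (power_space n M)"
  using measurable_space[OF measurable_resample[OF i L] x]
  by (auto simp: space_prob_algebra dest: sets_eq_imp_space_eq)

text \<open>
  The defining equation of a regular conditional law is invariance of \<open>\<nu>\<close> under resampling, tested
  on rectangles only; as these generate the product sigma-algebra and are closed under
  intersection, the two measures agree.
\<close>

lemma bind_resample_eq:
  assumes \<nu>: "prob_space \<nu>" and sets_\<nu>: "sets \<nu> = sets (power_space n M)"
    and i: "i \<in> {1..n}" and L: "regular_conditional_law n M \<nu> i L"
  shows "\<nu> \<bind> resample n M L i = \<nu>"
proof -
  interpret \<nu>: prob_space \<nu> by (rule \<nu>)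
  have space_\<nu>: "space \<nu> = space (power_space n M)"
    using sets_\<nu> by (rule sets_eq_imp_space_eq)
  have R: "resample n M L i \<in> \<nu> \<rightarrow>\<^sub>M subprob_algebra (power_space n M)"
    using measurable_prob_algebraD[OF measurable_resample[OF i L]] sets_\<nu>
    by (simp cong: measurable_cong_sets)
  show ?thesis
  proof (rule measure_eqI_PiM_finite[where I = "{1..n}" and M = "\<lambda>_. M"])
    show "sets (\<nu> \<bind> resample n M L i) = sets (power_space n M)"
      by (rule sets_bind_measurable[OF R \<nu>.not_empty])
    fix A :: "nat \<Rightarrow> 'a set" assume A: "\<And>j. j \<in> {1..n} \<Longrightarrow> A j \<in> sets M"
    let ?R = "Pi\<^sub>E ({1..n} - {i}) A"
    have PiE_A: "Pi\<^sub>E {1..n} A \<in> sets (power_space n M)"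
      using A by (intro sets_PiM_I_finite) auto
    have rectangle_iff: "z \<in> Pi\<^sub>E {1..n} A \<longleftrightarrow> others n i z \<in> ?R \<and> z i \<in> A i"
      if "z \<in> space (power_space n M)" for z
      using that i by (auto simp: others_def PiE_def Pi_def space_PiM)
    have at_point: "emeasure (resample n M L i x) (Pi\<^sub>E {1..n} A)
        = indicator ?R (others n i x) * emeasure (L (others n i x)) (A i)"
      if x: "x \<in> space (power_space n M)" for x
    proof -
      have sets_L: "sets (L (others n i x)) = sets M"
        by (rule conditional_law_at_point(2)[OF L x])
      note space_L = sets_eq_imp_space_eq[OF sets_L]
      have others_upd: "others n i (x(i := y)) = others n i x" for y
        by (auto simp: others_def fun_eq_iff)
      have "x(i := y) \<in> Pi\<^sub>E {1..n} A \<longleftrightarrow> others n i x \<in> ?R \<and> y \<in> A i" if "y \<in> space M" for y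
        using rectangle_iff[OF update_in_power_space[OF i x that]] by (simp add: others_upd)
      then have "(\<lambda>y. x(i := y)) -` Pi\<^sub>E {1..n} A \<inter> space (L (others n i x))
          = (if others n i x \<in> ?R then A i else {})"
        using sets.sets_into_space[OF A[OF i]] unfolding space_L vimage_def by auto
      then show ?thesis
        unfolding resample_def
        by (subst emeasure_distr[OF measurable_update_at_point[OF i x sets_L] PiE_A]) auto
    qed
    have "emeasure (\<nu> \<bind> resample n M L i) (Pi\<^sub>E {1..n} A)
        = (\<integral>\<^sup>+x. emeasure (resample n M L i x) (Pi\<^sub>E {1..n} A) \<partial>\<nu>)"
      by (rule emeasure_bind[OF \<nu>.not_empty R PiE_A])
    also have "\<dots> = (\<integral>\<^sup>+x. indicator ?R (others n i x) * emeasure (L (others n i x)) (A i) \<partial>\<nu>)"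
      by (intro nn_integral_cong at_point) (simp add: space_\<nu>)
    also have "\<dots> = emeasure \<nu> {x \<in> space \<nu>. others n i x \<in> ?R \<and> x i \<in> A i}"
    proof -
      have "?R \<in> sets (Pi\<^sub>M ({1..n} - {i}) (\<lambda>_. M))"
        using A by (intro sets_PiM_I_finite) auto
      then show ?thesis
        using L A[OF i] unfolding regular_conditional_law_def by simp
    qed
    also have "{x \<in> space \<nu>. others n i x \<in> ?R \<and> x i \<in> A i} = Pi\<^sub>E {1..n} A"
      using rectangle_iff sets.sets_into_space[OF PiE_A] by (auto simp: space_\<nu>)
    finally show "emeasure (\<nu> \<bind> resample n M L i) (Pi\<^sub>E {1..n} A) = emeasure \<nu> (Pi\<^sub>E {1..n} A)" .
  next
    show "range (\<lambda>_::nat. space (power_space n M)) \<subseteq> prod_algebra {1..n} (\<lambda>_. M)"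
      by (auto simp: space_PiM intro!: prod_algebraI_finite)
    show "emeasure (\<nu> \<bind> resample n M L i) (space (power_space n M)) \<noteq> \<infinity>"
      using subprob_space.subprob_emeasure_le_1[OF subprob_space_bind[OF prob_space_imp_subprob_space[OF \<nu>] R],
          of "space (power_space n M)"] by (auto simp: top_unique)
  qed (use sets_\<nu> in auto)
qed

text \<open>
  The third claim is the tower property: conditional means average to the mean.
\<close>

lemma integral_resample:
  fixes g :: "(nat \<Rightarrow> 'a) \<Rightarrow> real"
  assumes \<nu>: "prob_space \<nu>" and sets_\<nu>: "sets \<nu> = sets (power_space n M)"
    and i: "i \<in> {1..n}" and L: "regular_conditional_law n M \<nu> i L"
    and g: "g \<in> borel_measurable (power_space n M)"
    and bd: "\<And>x. x \<in> space (power_space n M) \<Longrightarrow> \<bar>g x\<bar> \<le> C"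
  shows "(\<lambda>x. \<integral>z. g z \<partial>resample n M L i x) \<in> borel_measurable \<nu>"
    and "integrable \<nu> (\<lambda>x. \<integral>z. g z \<partial>resample n M L i x)"
    and "(\<integral>x. \<integral>z. g z \<partial>resample n M L i x \<partial>\<nu>) = (\<integral>x. g x \<partial>\<nu>)"
proof -
  interpret \<nu>: prob_space \<nu> by (rule \<nu>)
  have space_\<nu>: "space \<nu> = space (power_space n M)"
    using sets_\<nu> by (rule sets_eq_imp_space_eq)
  note R_space = resample_at_point[OF i L]
  have R: "resample n M L i \<in> \<nu> \<rightarrow>\<^sub>M subprob_algebra (power_space n M)"
    using measurable_prob_algebraD[OF measurable_resample[OF i L]] sets_\<nu>
    by (simp cong: measurable_cong_sets)
  show meas: "(\<lambda>x. \<integral>z. g z \<partial>resample n M L i x) \<in> borel_measurable \<nu>"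
    by (rule measurable_compose[OF R integral_measurable_subprob_algebra[OF g]])
  show "integrable \<nu> (\<lambda>x. \<integral>z. g z \<partial>resample n M L i x)"
  proof (rule \<nu>.integrable_const_bound[OF _ meas])
    show "AE x in \<nu>. norm (\<integral>z. g z \<partial>resample n M L i x) \<le> C"
    proof (rule AE_I2)
      fix x assume "x \<in> space \<nu>"
      then have x: "x \<in> space (power_space n M)" by (simp add: space_\<nu>)
      interpret N: prob_space "resample n M L i x" by (rule R_space(1)[OF x])
      have bd_N: "AE z in resample n M L i x. \<bar>g z\<bar> \<le> C"
        using bd by (intro AE_I2) (simp add: R_space(3)[OF x])
      have "integrable (resample n M L i x) g"
        by (rule N.integrable_const_bound[of _ C])
           (use bd_N g in \<open>simp_all cong: measurable_cong_sets add: R_space(2)[OF x]\<close>)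
      then have "(\<integral>z. \<bar>g z\<bar> \<partial>resample n M L i x) \<le> C"
        by (intro N.integral_le_const integrable_abs bd_N)
      then show "norm (\<integral>z. g z \<partial>resample n M L i x) \<le> C"
        using integral_abs_bound[of "resample n M L i x" g] unfolding real_norm_def by linarith
    qed
  qed
  have "AE x in \<nu>. emeasure (resample n M L i x) (space (resample n M L i x)) \<le> ennreal 1"
    by (intro AE_I2) (simp add: space_\<nu> R_space(1) prob_space.emeasure_space_1)
  from integral_bind[OF g bd R \<nu>.finite_measure_axioms this]
  show "(\<integral>x. \<integral>z. g z \<partial>resample n M L i x \<partial>\<nu>) = (\<integral>x. g x \<partial>\<nu>)"
    by (simp add: bind_resample_eq[OF \<nu> sets_\<nu> i L])
qed

lemma cond_Ent_eq_Ent_resample: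
  assumes i: "i \<in> {1..n}" and L: "regular_conditional_law n M \<nu> i (K i)"
    and x: "x \<in> space (power_space n M)" and f: "f \<in> borel_measurable (power_space n M)"
  shows "cond_Ent n K i f x = Ent (resample n M (K i) i x) f"
proof -
  have upd: "(\<lambda>y. x(i := y)) \<in> K i (others n i x) \<rightarrow>\<^sub>M power_space n M"
    by (rule measurable_update_at_point[OF i x conditional_law_at_point(2)[OF L x]])
  show ?thesis
    unfolding cond_Ent_def Ent_def resample_def
    by (subst (1 2 3) integral_distr[OF upd]) (use f in simp_all)
qed

section \<open>Concentration from approximate tensorization of entropy\<close>

lemma integrable_cond_Ent_exp:
  assumes \<nu>: "prob_space \<nu>" and sets_\<nu>: "sets \<nu> = sets (power_space n M)"
    and i: "i \<in> {1..n}" and L: "regular_conditional_law n M \<nu> i (K i)"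
    and f: "f \<in> borel_measurable (power_space n M)"
    and bd: "\<And>x. x \<in> space (power_space n M) \<Longrightarrow> \<bar>f x\<bar> \<le> B"
  shows "integrable \<nu> (cond_Ent n K i (\<lambda>x. exp (f x)))"
proof -
  interpret \<nu>: prob_space \<nu> by (rule \<nu>)
  have space_\<nu>: "space \<nu> = space (power_space n M)"
    using sets_\<nu> by (rule sets_eq_imp_space_eq)
  let ?R = "resample n M (K i) i"
  note mean_meas = integral_resample(1)[OF \<nu> sets_\<nu> i L]
  have exp_meas: "(\<lambda>x. \<integral>z. exp (f z) \<partial>?R x) \<in> borel_measurable \<nu>"
    by (rule mean_meas[where C = "exp B"]) (use f bd in \<open>auto simp: abs_le_iff\<close>)
  have exp_f_meas: "(\<lambda>x. \<integral>z. exp (f z) * f z \<partial>?R x) \<in> borel_measurable \<nu>"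
    by (rule mean_meas[where C = "exp B * B"])
       (use f bd in \<open>auto simp: abs_mult abs_le_iff intro!: mult_mono\<close>)
  have "integrable \<nu> (\<lambda>x. Ent (?R x) (\<lambda>z. exp (f z)))"
  proof (rule \<nu>.integrable_const_bound)
    show "(\<lambda>x. Ent (?R x) (\<lambda>z. exp (f z))) \<in> borel_measurable \<nu>"
      unfolding Ent_def ln_exp using exp_meas exp_f_meas by measurable
    show "AE x in \<nu>. norm (Ent (?R x) (\<lambda>z. exp (f z))) \<le> 2 * (exp B * B)"
    proof (rule AE_I2)
      fix x assume "x \<in> space \<nu>"
      then have x: "x \<in> space (power_space n M)" by (simp add: space_\<nu>)
      note R = resample_at_point[OF i L x]
      interpret N: prob_space "?R x" by (rule R(1))
      have "f \<in> borel_measurable (?R x)"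
        using f by (simp cong: measurable_cong_sets add: R(2))
      then show "norm (Ent (?R x) (\<lambda>z. exp (f z))) \<le> 2 * (exp B * B)"
        using N.abs_Ent_exp_le[of f B] bd by (simp add: R(3))
    qed
  qed
  moreover have "cond_Ent n K i (\<lambda>x. exp (f x)) x = Ent (?R x) (\<lambda>z. exp (f z))"
    if "x \<in> space \<nu>" for x
    using that f by (intro cond_Ent_eq_Ent_resample[where K = K and i = i, OF i L]) (auto simp: space_\<nu>)
  ultimately show ?thesis
    by (simp cong: Bochner_Integration.integrable_cong)
qed

lemma cond_Ent_exp_le:
  assumes i: "i \<in> {1..n}" and L: "regular_conditional_law n M \<nu> i (K i)"
    and f: "f \<in> borel_measurable (power_space n M)"
    and bd: "bounded_differences n M c f"
    and x: "x \<in> space (power_space n M)"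
  shows "cond_Ent n K i (\<lambda>x. exp (f x)) x \<le> (c i)\<^sup>2 / 8 * (\<integral>z. exp (f z) \<partial>resample n M (K i) i x)"
proof -
  let ?L = "K i (others n i x)"
  interpret L: prob_space ?L by (rule conditional_law_at_point(1)[OF L x])
  have sets_L: "sets ?L = sets M" by (rule conditional_law_at_point(2)[OF L x])
  note space_L = sets_eq_imp_space_eq[OF sets_L]
  note upd = measurable_update_at_point[OF i x sets_L]
  have "Ent ?L (\<lambda>y. exp (f (x(i := y)))) \<le> (c i)\<^sup>2 / 8 * (\<integral>y. exp (f (x(i := y))) \<partial>?L)"
  proof (rule L.Ent_exp_le_oscillation)
    show "(\<lambda>y. f (x(i := y))) \<in> borel_measurable ?L"
      by (rule measurable_compose[OF upd f])
    fix y y' assume "y \<in> space ?L" "y' \<in> space ?L"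
    then have "\<bar>f (x(i := y)) - f ((x(i := y))(i := y'))\<bar> \<le> c i"
      using bd i update_in_power_space[OF i x, of y] unfolding bounded_differences_def space_L
      by blast
    then show "\<bar>f (x(i := y)) - f (x(i := y'))\<bar> \<le> c i" by simp
  qed
  then show ?thesis
    unfolding cond_Ent_def resample_def
    by (subst integral_distr[OF upd]) (use f in simp_all)
qed

text \<open>
  Each conditional law sees \<open>f\<close> oscillate by at most \<open>c i\<close>, so the bound for one variable applies to
  it; averaging over \<open>\<nu>\<close> turns the conditional mean of \<open>exp f\<close> into its mean, because \<open>\<nu>\<close> is
  invariant under resampling. Tensorization then adds up the coordinates.
\<close>

lemma approx_tensorization_Ent_exp_le:
  assumes \<nu>: "prob_space \<nu>" and sets_\<nu>: "sets \<nu> = sets (power_space n M)"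
    and K: "\<And>i. i \<in> {1..n} \<Longrightarrow> regular_conditional_law n M \<nu> i (K i)"
    and \<kappa>: "\<kappa> \<ge> 0" and ATE: "approx_tensorization_entropy n \<nu> K \<kappa>"
    and f: "f \<in> borel_measurable (power_space n M)"
    and bd: "bounded_differences n M c f"
  shows "Ent \<nu> (\<lambda>x. exp (f x)) \<le> \<kappa> * (\<Sum>i = 1..n. (c i)\<^sup>2) / 8 * (\<integral>x. exp (f x) \<partial>\<nu>)"
proof -
  interpret \<nu>: prob_space \<nu> by (rule \<nu>)
  have space_\<nu>: "space \<nu> = space (power_space n M)"
    using sets_\<nu> by (rule sets_eq_imp_space_eq)
  have f_\<nu>: "f \<in> borel_measurable \<nu>"
    using f sets_\<nu> by (simp cong: measurable_cong_sets)
  obtain x0 where x0: "x0 \<in> space \<nu>"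
    using \<nu>.not_empty by blast
  define B where "B = (\<Sum>i = 1..n. c i) + \<bar>f x0\<bar>"
  have f_B: "\<bar>f x\<bar> \<le> B" if "x \<in> space (power_space n M)" for x
    using bounded_differences_imp_dist_le[OF bd that, of x0] x0 by (simp add: B_def space_\<nu>)
  let ?h = "\<lambda>x. exp (f x)"
  have int_cond: "integrable \<nu> (cond_Ent n K i ?h)" if i: "i \<in> {1..n}" for i
    by (rule integrable_cond_Ent_exp[where K = K and i = i, OF \<nu> sets_\<nu> i K[OF i] f f_B])
  have mean_cond_Ent_le: "(\<integral>x. cond_Ent n K i ?h x \<partial>\<nu>) \<le> (c i)\<^sup>2 / 8 * (\<integral>x. ?h x \<partial>\<nu>)"
    if i: "i \<in> {1..n}" for i
  proof -
    have h: "?h \<in> borel_measurable (power_space n M)"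
      using f by simp
    have h_B: "\<bar>?h x\<bar> \<le> exp B" if "x \<in> space (power_space n M)" for x
      using f_B[OF that] by simp
    note mean = integral_resample[OF \<nu> sets_\<nu> i K[OF i] h h_B]
    have "(\<integral>x. cond_Ent n K i ?h x \<partial>\<nu>)
        \<le> (\<integral>x. (c i)\<^sup>2 / 8 * (\<integral>z. ?h z \<partial>resample n M (K i) i x) \<partial>\<nu>)"
    proof (rule integral_mono[OF int_cond[OF i] integrable_mult_right[OF mean(2)]])
      show "cond_Ent n K i ?h x \<le> (c i)\<^sup>2 / 8 * (\<integral>z. ?h z \<partial>resample n M (K i) i x)"
        if "x \<in> space \<nu>" for x
        using cond_Ent_exp_le[where K = K and i = i and x = x, OF i K[OF i] f bd] that by (simp only: space_\<nu>)
    qed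
    also have "\<dots> = (c i)\<^sup>2 / 8 * (\<integral>x. ?h x \<partial>\<nu>)"
      by (simp only: integral_mult_right_zero mean(3))
    finally show ?thesis .
  qed
  have exists_at: "Ent_exists (K i (others n i x)) (\<lambda>y. ?h (x(i := y)))"
    if i: "i \<in> {1..n}" and x: "x \<in> space \<nu>" for i x
  proof -
    have x': "x \<in> space (power_space n M)" using x by (simp add: space_\<nu>)
    have sets_L: "sets (K i (others n i x)) = sets M"
      by (rule conditional_law_at_point(2)[OF K[OF i] x'])
    show ?thesis
    proof (rule prob_space.Ent_exists_exp_bounded[OF conditional_law_at_point(1)[OF K[OF i] x']])
      show "(\<lambda>y. f (x(i := y))) \<in> borel_measurable (K i (others n i x))"
        by (rule measurable_compose[OF measurable_update_at_point[OF i x' sets_L] f])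
      show "\<bar>f (x(i := y))\<bar> \<le> B" if "y \<in> space (K i (others n i x))" for y
        using that by (intro f_B update_in_power_space[OF i x'])
          (simp add: sets_eq_imp_space_eq[OF sets_L])
    qed
  qed
  have "Ent_exists \<nu> ?h"
    by (rule \<nu>.Ent_exists_exp_bounded[OF f_\<nu>, of B]) (simp add: f_B space_\<nu>)
  then have "Ent \<nu> ?h \<le> \<kappa> * (\<Sum>i = 1..n. \<integral>x. cond_Ent n K i ?h x \<partial>\<nu>)"
    using ATE int_cond exists_at unfolding approx_tensorization_entropy_def by simp
  also have "\<dots> \<le> \<kappa> * (\<Sum>i = 1..n. (c i)\<^sup>2 / 8 * (\<integral>x. ?h x \<partial>\<nu>))"
    using \<kappa> mean_cond_Ent_le by (intro mult_left_mono sum_mono) auto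
  also have "\<dots> = \<kappa> * (\<Sum>i = 1..n. (c i)\<^sup>2) / 8 * (\<integral>x. ?h x \<partial>\<nu>)"
    by (simp add: sum_distrib_right[symmetric] sum_divide_distrib[symmetric])
  finally show ?thesis .
qed

lemma approx_tensorization_tail_bound:
  assumes \<nu>: "prob_space \<nu>" and sets_\<nu>: "sets \<nu> = sets (power_space n M)"
    and K: "\<And>i. i \<in> {1..n} \<Longrightarrow> regular_conditional_law n M \<nu> i (K i)"
    and \<kappa>: "\<kappa> > 0" and ATE: "approx_tensorization_entropy n \<nu> K \<kappa>"
    and f: "f \<in> borel_measurable (power_space n M)"
    and bd: "bounded_differences n M c f"
    and c: "(\<Sum>i = 1..n. (c i)\<^sup>2) > 0" and t: "t > 0"
  shows "measure \<nu> {x \<in> space \<nu>. f x - (\<integral>x. f x \<partial>\<nu>) \<ge> t}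
    \<le> exp (- (2 * t\<^sup>2 / (\<kappa> * (\<Sum>i = 1..n. (c i)\<^sup>2))))"
proof -
  interpret \<nu>: prob_space \<nu> by (rule \<nu>)
  have space_\<nu>: "space \<nu> = space (power_space n M)"
    using sets_\<nu> by (rule sets_eq_imp_space_eq)
  have f_\<nu>: "f \<in> borel_measurable \<nu>"
    using f sets_\<nu> by (simp cong: measurable_cong_sets)
  obtain x0 where "x0 \<in> space \<nu>"
    using \<nu>.not_empty by blast
  then have x0: "x0 \<in> space (power_space n M)" by (simp add: space_\<nu>)
  \<comment> \<open>The variance proxy: scaling \<open>f\<close> by \<open>l\<close> scales its differences, so the entropy bound for
    \<open>l * f\<close> has the factor \<open>\<kappa> * (\<Sum>i. (l * c i)\<^sup>2) / 8 = l\<^sup>2 * v / 2\<close>.\<close>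
  define v where "v = \<kappa> * (\<Sum>i = 1..n. (c i)\<^sup>2) / 4"
  have "v > 0" using \<kappa> c by (simp add: v_def)
  have "measure \<nu> {x \<in> space \<nu>. f x - (\<integral>x. f x \<partial>\<nu>) \<ge> t} \<le> exp (- (t\<^sup>2 / (2 * v)))"
  proof (rule \<nu>.Herbst_tail_bound[OF f_\<nu> _ _ \<open>v > 0\<close> t])
    show "\<bar>f x\<bar> \<le> (\<Sum>i = 1..n. c i) + \<bar>f x0\<bar>" if "x \<in> space \<nu>" for x
      using bounded_differences_imp_dist_le[OF bd _ x0, of x] that by (simp add: space_\<nu>)
    show "Ent \<nu> (\<lambda>x. exp (l * f x)) \<le> l\<^sup>2 * v / 2 * (\<integral>x. exp (l * f x) \<partial>\<nu>)" for l
    proof -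
      have "Ent \<nu> (\<lambda>x. exp (l * f x))
          \<le> \<kappa> * (\<Sum>i = 1..n. (\<bar>l\<bar> * c i)\<^sup>2) / 8 * (\<integral>x. exp (l * f x) \<partial>\<nu>)"
        using \<kappa> f by (intro approx_tensorization_Ent_exp_le[OF \<nu> sets_\<nu> K _ ATE]
                             bounded_differences_scale[OF bd]) auto
      also have "\<kappa> * (\<Sum>i = 1..n. (\<bar>l\<bar> * c i)\<^sup>2) / 8 = l\<^sup>2 * v / 2"
        by (simp add: v_def power_mult_distrib sum_distrib_left[symmetric])
      finally show ?thesis .
    qed
  qed
  also have "t\<^sup>2 / (2 * v) = 2 * t\<^sup>2 / (\<kappa> * (\<Sum>i = 1..n. (c i)\<^sup>2))"
    by (simp add: v_def)
  finally show ?thesis .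
qed

theorem theorem2p4:
  fixes M :: "'a measure"
    and n :: nat
    and \<nu> :: "(nat \<Rightarrow> 'a) measure"
    and K :: "nat \<Rightarrow> (nat \<Rightarrow> 'a) \<Rightarrow> 'a measure"
    and \<kappa> :: real
    and P :: "'w measure"
    and X :: "'w \<Rightarrow> nat \<Rightarrow> 'a"
    and f :: "(nat \<Rightarrow> 'a) \<Rightarrow> real"
    and c :: "nat \<Rightarrow> real"
    and t :: real
  assumes "prob_space \<nu>"
    and "sets \<nu> = sets (power_space n M)"
    and "\<And>i. i \<in> {1..n} \<Longrightarrow> regular_conditional_law n M \<nu> i (K i)"
    and "\<kappa> \<ge> 1"
    and "approx_tensorization_entropy n \<nu> K \<kappa>"
    and "prob_space P"
    and "X \<in> measurable P (power_space n M)"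
    and "distr P (power_space n M) X = \<nu>"
    and "f \<in> borel_measurable (power_space n M)"
    and "\<And>i. i \<in> {1..n} \<Longrightarrow> c i \<ge> 0"
    and "bounded_differences n M c f"
    and "t > 0"
  shows "measure P {\<omega> \<in> space P. \<bar>f (X \<omega>) - (\<integral>\<omega>'. f (X \<omega>') \<partial>P)\<bar> \<ge> t}
    \<le> (if \<forall>i \<in> {1..n}. c i = 0 then 0
       else 2 * exp (- (2 * t\<^sup>2 / (\<kappa> * (L2_set c {1..n})\<^sup>2))))"
proof -
  interpret P: prob_space P by fact
  interpret \<nu>: prob_space \<nu> by fact
  have X [measurable]: "X \<in> P \<rightarrow>\<^sub>M power_space n M" and f [measurable]: "f \<in> borel_measurable (power_space n M)"
    by fact+
  have space_\<nu>: "space \<nu> = space (power_space n M)"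
    using assms(2) by (rule sets_eq_imp_space_eq)
  have f_\<nu> [measurable]: "f \<in> borel_measurable \<nu>"
    using f assms(2) by (simp cong: measurable_cong_sets)
  define m where "m = (\<integral>x. f x \<partial>\<nu>)"
  have mean: "(\<integral>\<omega>. f (X \<omega>) \<partial>P) = m"
    unfolding m_def assms(8)[symmetric] by (rule integral_distr[OF X f, symmetric])
  \<comment> \<open>The event only depends on the law \<open>\<nu>\<close> of \<open>X\<close>.\<close>
  have "measure \<nu> {x \<in> space \<nu>. \<bar>f x - m\<bar> \<ge> t} =
      measure P (X -` {x \<in> space \<nu>. \<bar>f x - m\<bar> \<ge> t} \<inter> space P)"
    by (subst assms(8)[symmetric], rule measure_distr[OF X]) (unfold assms(2)[symmetric], measurable)
  also have "X -` {x \<in> space \<nu>. \<bar>f x - m\<bar> \<ge> t} \<inter> space P = {\<omega> \<in> space P. \<bar>f (X \<omega>) - m\<bar> \<ge> t}"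
    using measurable_space[OF X] by (auto simp: space_\<nu>)
  finally have law: "measure P {\<omega> \<in> space P. \<bar>f (X \<omega>) - (\<integral>\<omega>'. f (X \<omega>') \<partial>P)\<bar> \<ge> t}
      = measure \<nu> {x \<in> space \<nu>. \<bar>f x - m\<bar> \<ge> t}"
    by (simp add: mean)
  show ?thesis
  proof (cases "\<forall>i \<in> {1..n}. c i = 0")
    case True
    obtain x0 where x0: "x0 \<in> space \<nu>"
      using \<nu>.not_empty by blast
    have const: "f x = f x0" if "x \<in> space \<nu>" for x
      using bounded_differences_imp_dist_le[OF assms(11), of x x0] that x0 True by (simp add: space_\<nu>)
    have "m = (\<integral>x. f x0 \<partial>\<nu>)"
      unfolding m_def by (rule Bochner_Integration.integral_cong[OF refl const])
    then have "m = f x0" by (simp add: \<nu>.prob_space)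
    then have empty: "{x \<in> space \<nu>. \<bar>f x - m\<bar> \<ge> t} = {}"
      using const \<open>t > 0\<close> by auto
    show ?thesis
      unfolding law empty using True by simp
  next
    case False
    let ?e = "exp (- (2 * t\<^sup>2 / (\<kappa> * (\<Sum>i = 1..n. (c i)\<^sup>2))))"
    have c: "(\<Sum>i = 1..n. (c i)\<^sup>2) > 0"
      using False by (auto intro!: sum_pos2)
    have \<kappa>: "\<kappa> > 0" using \<open>\<kappa> \<ge> 1\<close> by simp
    have bd_neg: "bounded_differences n M c (\<lambda>x. - f x)"
      using bounded_differences_scale[OF assms(11), of "-1"] by simp
    have upper: "measure \<nu> {x \<in> space \<nu>. f x - m \<ge> t} \<le> ?e"
      unfolding m_def
      by (rule approx_tensorization_tail_bound[OF assms(1-3) \<kappa> assms(5) f assms(11) c \<open>t > 0\<close>])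
    have lower: "measure \<nu> {x \<in> space \<nu>. - f x + m \<ge> t} \<le> ?e"
      using approx_tensorization_tail_bound[OF assms(1-3) \<kappa> assms(5) borel_measurable_uminus[OF f]
          bd_neg c \<open>t > 0\<close>] by (simp add: m_def)
    have "{x \<in> space \<nu>. \<bar>f x - m\<bar> \<ge> t}
        = {x \<in> space \<nu>. f x - m \<ge> t} \<union> {x \<in> space \<nu>. - f x + m \<ge> t}"
      by (auto simp: abs_real_def)
    then have "measure \<nu> {x \<in> space \<nu>. \<bar>f x - m\<bar> \<ge> t}
        \<le> measure \<nu> {x \<in> space \<nu>. f x - m \<ge> t} + measure \<nu> {x \<in> space \<nu>. - f x + m \<ge> t}"
      by (simp add: measure_Un_le)
    also have "\<dots> \<le> 2 * ?e" using upper lower by simp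
    also have "(\<Sum>i = 1..n. (c i)\<^sup>2) = (L2_set c {1..n})\<^sup>2"
      by (simp add: L2_set_def sum_nonneg)
    finally show ?thesis
      unfolding law using False by auto
  qed
qed

end
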